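(* Let $\lambda\in\mathbb{R}$ with $\lambda\notin\Lambda^{K^*}$, and define $g_\lambda:\mathbb{R}^{n\times m}\to\mathbb{R}$ by $g_\lambda(K):=|\Phi(P_K,\lambda)|$. Then the Kalman gain $K^*$ is a critical point of $g_\lambda$. If moreover $\lambda<\lambda_1^{K^*}$, then $K^*$ minimizes $g_\lambda$, i.e. $$K^*=\arg\min_{K\in\mathbb{R}^{n\times m}} g_\lambda(K).$$
   Context: Let $P\in\mathbb{R}^{n\times n}$ (prior covariance) and $R\in\mathbb{R}^{m\times m}$ (likelihood covariance) be symmetric and positive definite, and let $H\in\mathbb{R}^{m\times n}$ (measurement operator). The Kalman gain is $K^*=PH^\top(HPH^\top+R)^{-1}\in\mathbb{R}^{n\times m}$. For $K\in\mathbb{R}^{n\times m}$ set $P_K=(I-KH)P(I-KH)^\top+KRK^\top$, where $I$ is the $n\times n$ identity matrix; $P_K$ is symmetric and positive definite, and $P_{K^*}$ is the posterior covariance. Let $\Phi(P_K,\lambda):=\det(\lambda I-P_K)$ be the characteristic polynomial of $P_K$, let $0<\lambda_1^K\le\dots\le\lambda_n^K$ be the eigenvalues of $P_K$ with multiplicity, and let $\Lambda^K=\{\lambda_i^K\}_{i=1}^n$. A critical point of a real-valued function of $K$ is a point where its derivative with respect to $K$ exists and vanishes. The notation $K^*=\arg\min_K f(K)$ means that $K^*$ is a global minimizer: $f(K^* )\le f(K)$ for all $K\in\mathbb{R}^{n\times m}$. *)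

theory Defs
  imports "HOL-Analysis.Analysis"
begin

definition sym_pos_def :: "real^'n^'n \<Rightarrow> bool" where
  "sym_pos_def A \<longleftrightarrow> transpose A = A \<and> (\<forall>x. x \<noteq> 0 \<longrightarrow> x \<bullet> (A *v x) > 0)"

definition kalman_gain :: "real^'n^'n \<Rightarrow> real^'m^'m \<Rightarrow> real^'n^'m \<Rightarrow> real^'m^'n" where
  "kalman_gain P R H = P ** transpose H ** matrix_inv (H ** P ** transpose H + R)"

definition cov :: "real^'n^'n \<Rightarrow> real^'m^'m \<Rightarrow> real^'n^'m \<Rightarrow> real^'m^'n \<Rightarrow> real^'n^'n" where
  "cov P R H K =
     (mat 1 - K ** H) ** P ** transpose (mat 1 - K ** H) + K ** R ** transpose K"

definition char_fun :: "real^'n^'n \<Rightarrow> real \<Rightarrow> real" where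
  "char_fun A lam = det (lam *\<^sub>R mat 1 - A)"

definition eigenvalues :: "real^'n^'n \<Rightarrow> real set" where
  "eigenvalues A = {mu. \<exists>v. v \<noteq> 0 \<and> A *v v = mu *\<^sub>R v}"

(* Used only for symmetric matrices, whose set of eigenvalues is finite and nonempty;
   for other matrices Min may be unspecified. *)
definition smallest_eigenvalue :: "real^'n^'n \<Rightarrow> real" where
  "smallest_eigenvalue A = Min (eigenvalues A)"

(* Joint (Frechet) differentiability in all entries, not mere existence of partial derivatives. *)
definition critical_point :: "('a::real_normed_vector \<Rightarrow> real) \<Rightarrow> 'a \<Rightarrow> bool" where
  "critical_point f x \<longleftrightarrow> (f has_derivative (\<lambda>_. 0)) (at x)"

end

theory Submission
  imports Defs
begin

text \<open>
  Write \<open>S = H P H\<^sup>T + R\<close>, which is symmetric positive definite, and let \<open>G\<close> be the Kalman gain,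
  so that \<open>G S = P H\<^sup>T\<close>. Completing the square in \<open>K\<close> gives
  \<open>P\<^sub>K = P\<^sub>G + (K - G) S (K - G)\<^sup>T\<close> (\<open>cov_completed_square\<close>), and both claims follow from this
  identity.

  Near \<open>G\<close> every entry of \<open>\<lambda>I - P\<^sub>K\<close> is a constant plus a quadratic form in \<open>K - G\<close>, so its
  derivative at \<open>G\<close> vanishes. The determinant is a polynomial in the entries, so its derivative
  vanishes too, and the absolute value does no harm because \<open>\<lambda>\<close> is not an eigenvalue of \<open>P\<^sub>G\<close>.

  If \<open>\<lambda>\<close> lies below the spectrum of \<open>P\<^sub>G\<close>, then \<open>B = P\<^sub>G - \<lambda>I\<close> has positive eigenvalues, and
  \<open>\<bar>det (\<lambda>I - P\<^sub>K)\<bar> = \<bar>det (B + C)\<bar>\<close> with \<open>C = (K - G) S (K - G)\<^sup>T\<close> positive semidefinite. So minimality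
  is the monotonicity of the determinant, \<open>0 < det B \<le> det (B + C)\<close> (\<open>det_mono_psd\<close>). A congruence
  \<open>T\<^sup>T B T = I\<close> reduces it to \<open>det (I + E) \<ge> 1\<close> for positive semidefinite \<open>E\<close>, where the determinant is
  the product of the numbers \<open>1 + d\<^sub>i\<close> with \<open>d\<^sub>i \<ge> 0\<close> the eigenvalues of \<open>E\<close>. Both steps need an
  orthonormal eigenbasis of a real symmetric matrix, which is constructed here by a
  compactness argument.
\<close>

section \<open>Orthonormal eigenbases of symmetric matrices\<close>

lemma symmetric_matrix_inner:
  fixes A :: "real^'n^'n"
  assumes "transpose A = A"
  shows "x \<bullet> (A *v y) = (A *v x) \<bullet> y"
  by (metis assms dot_lmul_matrix transpose_matrix_vector)

text \<open>
  A minimizer \<open>v\<close> of the Rayleigh quotient on the unit sphere of \<open>W\<close> is an eigenvector: with the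
  minimum \<open>mu\<close>, the form \<open>q x = x \<bullet> A x - mu (x \<bullet> x)\<close> is nonnegative on \<open>W\<close> and vanishes at \<open>v\<close>, so it
  is stationary there. Invariance of \<open>W\<close> is what puts the residual \<open>A v - mu v\<close> itself into \<open>W\<close>, where
  it can be used as the direction of variation.
\<close>

lemma symmetric_matrix_eigenvector_in_subspace:
  fixes A :: "real^'n^'n"
  assumes sym: "transpose A = A" and W: "subspace W" and inv: "\<And>x. x \<in> W \<Longrightarrow> A *v x \<in> W"
    and nontriv: "w0 \<in> W" "w0 \<noteq> 0"
  obtains v mu where "v \<in> W" "norm v = 1" "A *v v = mu *\<^sub>R v"
proof -
  let ?S = "W \<inter> sphere 0 1"
  have "compact ?S"
    using closed_subspace[OF W] by (simp add: closed_Int_compact)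
  moreover have "w0 /\<^sub>R norm w0 \<in> ?S"
    using nontriv W by (simp add: subspace_scale)
  moreover have "continuous_on ?S (\<lambda>x. x \<bullet> (A *v x))"
    by (intro continuous_intros linear_continuous_on matrix_vector_mul_bounded_linear)
  ultimately obtain v where v: "v \<in> ?S" and min: "\<And>x. x \<in> ?S \<Longrightarrow> v \<bullet> (A *v v) \<le> x \<bullet> (A *v x)"
    using continuous_attains_inf[of ?S "\<lambda>x. x \<bullet> (A *v x)"] by blast
  define mu where "mu = v \<bullet> (A *v v)"
  define q where "q x = x \<bullet> (A *v x) - mu * (x \<bullet> x)" for x
  have q_nonneg: "q x \<ge> 0" if "x \<in> W" for x
  proof (cases "x = 0")
    case False
    then have "x /\<^sub>R norm x \<in> ?S"
      using that W by (simp add: subspace_scale)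
    from min[OF this] have "mu \<le> (x \<bullet> (A *v x)) / (norm x)\<^sup>2"
      by (simp add: mu_def matrix_vector_mult_scaleR power2_eq_square field_simps)
    then show ?thesis
      using False by (simp add: q_def dot_square_norm field_simps)
  qed (simp add: q_def)
  define w where "w = A *v v - mu *\<^sub>R v"
  have wW: "w \<in> W"
    using v inv W by (auto simp: w_def subspace_diff subspace_scale)
  have "v \<bullet> v = 1"
    using v by (simp add: norm_eq_1)
  then have q_line: "q (v - t *\<^sub>R w) = t\<^sup>2 * q w - 2 * t * (w \<bullet> w)" for t
    using symmetric_matrix_inner[OF sym, of v w]
    by (simp add: q_def mu_def w_def matrix_vector_mult_diff_distrib matrix_vector_mult_scaleR
        inner_diff_left inner_diff_right inner_commute power2_eq_square algebra_simps)
  have "w \<bullet> w = 0"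
  proof (rule ccontr)
    assume "w \<bullet> w \<noteq> 0"
    then have pos: "w \<bullet> w > 0" by (metis inner_ge_zero less_eq_real_def)
    \<comment> \<open>A step small enough for the linear term of \<open>q (v - t *\<^sub>R w)\<close> to beat the quadratic one;
      the summand 1 covers the case \<open>q w = 0\<close>.\<close>
    define t where "t = (w \<bullet> w) / (q w + 1)"
    have q1: "q w \<ge> 0" by (rule q_nonneg[OF wW])
    then have t: "t > 0" using pos by (simp add: t_def)
    have "t * q w < w \<bullet> w + w \<bullet> w"
    proof -
      have "t * (q w + 1) = w \<bullet> w" using q1 by (simp add: t_def)
      then have "t * q w + t = w \<bullet> w" by (simp add: algebra_simps)
      then show ?thesis using t pos by linarith
    qed
    then have "t * (t * q w) < t * (w \<bullet> w + w \<bullet> w)" using t by simp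
    moreover have "q (v - t *\<^sub>R w) \<ge> 0"
      using v wW W by (intro q_nonneg) (auto simp: subspace_diff subspace_scale)
    ultimately show False
      unfolding q_line by (simp add: power2_eq_square algebra_simps)
  qed
  then have "A *v v = mu *\<^sub>R v" by (simp add: w_def)
  with v that show ?thesis by auto
qed

text \<open>
  An orthonormal set of eigenvectors of maximal size must span: its orthogonal complement is
  invariant, so a nonzero complement would contain another eigenvector.
\<close>

theorem symmetric_matrix_orthonormal_eigenbasis:
  fixes A :: "real^'n^'n"
  assumes sym: "transpose A = A"
  obtains f :: "'n \<Rightarrow> real^'n" and d :: "'n \<Rightarrow> real"
  where "\<And>i j. f i \<bullet> f j = (if i = j then 1 else 0)" and "\<And>i. A *v f i = d i *\<^sub>R f i"
    and "span (range f) = UNIV"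
proof -
  define good where "good B \<longleftrightarrow> pairwise orthogonal B \<and> (\<forall>b\<in>B. norm b = 1 \<and> (\<exists>mu. A *v b = mu *\<^sub>R b))" for B
  have good_indep: "independent B" if "good B" for B
    using that by (intro pairwise_orthogonal_independent) (auto simp: good_def)
  have card_le: "card B \<le> CARD('n)" if "good B" for B
    using independent_bound[OF good_indep[OF that]] by simp
  have "good {}" by (simp add: good_def)
  then obtain B where B: "good B" and max: "\<And>B'. good B' \<Longrightarrow> card B' \<le> card B"
    using ex_has_greatest_nat[of good "{}" card "Suc CARD('n)"] card_le by (metis le_imp_less_Suc)
  have finB: "finite B" using independent_bound[OF good_indep[OF B]] by simp
  have spanB: "span B = UNIV"
  proof (rule ccontr)
    assume "span B \<noteq> UNIV"
    then obtain w where w: "w \<noteq> 0" "\<And>x. x \<in> span B \<Longrightarrow> orthogonal w x"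
      using orthogonal_to_subspace_exists_gen[of B UNIV] by (auto simp: psubset_eq)
    let ?W = "{x. \<forall>b\<in>B. b \<bullet> x = 0}"
    have "subspace ?W" by (auto simp: subspace_def inner_add_right)
    moreover have "A *v x \<in> ?W" if "x \<in> ?W" for x
    proof -
      have "b \<bullet> (A *v x) = 0" if b: "b \<in> B" for b
      proof -
        obtain mu where "A *v b = mu *\<^sub>R b" using B b by (auto simp: good_def)
        then show ?thesis
          using symmetric_matrix_inner[OF sym, of b x] b \<open>x \<in> ?W\<close> by simp
      qed
      then show ?thesis by simp
    qed
    moreover have "w \<in> ?W"
      using w(2) by (auto simp: orthogonal_def inner_commute span_base)
    ultimately obtain v mu where v: "v \<in> ?W" "norm v = 1" "A *v v = mu *\<^sub>R v"
      using symmetric_matrix_eigenvector_in_subspace[OF sym _ _ _ w(1), of ?W] by blast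
    have "v \<notin> B" using v by (auto simp: norm_eq_1)
    moreover have "good (insert v B)"
      using B v unfolding good_def
      by (auto intro!: pairwise_orthogonal_insert simp: orthogonal_def inner_commute)
    ultimately show False using max[of "insert v B"] finB by simp
  qed
  have "card B = CARD('n)"
    using indep_card_eq_dim_span[OF good_indep[OF B]] spanB by simp
  then obtain f :: "'n \<Rightarrow> real^'n" where f: "bij_betw f UNIV B"
    using finB by (metis bij_betw_iff_card finite_class.finite_UNIV)
  then have ran: "range f = B" and fB: "\<And>i. f i \<in> B" and injf: "inj f" by (auto simp: bij_betw_def)
  have "\<forall>i. \<exists>mu. A *v f i = mu *\<^sub>R f i"
    using B fB unfolding good_def by blast
  then have "\<exists>d. \<forall>i. A *v f i = d i *\<^sub>R f i" by (rule choice)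
  then obtain d where "\<And>i. A *v f i = d i *\<^sub>R f i" by blast
  moreover have "f i \<bullet> f j = (if i = j then 1 else 0)" for i j
    using B fB[of i] fB[of j] injf
    by (auto simp: good_def pairwise_def orthogonal_def norm_eq_1 dest: injD)
  ultimately show ?thesis using that ran spanB by blast
qed

text \<open>
  An eigenvector cannot be orthogonal to the whole eigenbasis, and symmetry forces it to share its
  eigenvalue with any basis vector to which it is not orthogonal. Finiteness is what makes the
  minimum in \<open>smallest_eigenvalue\<close> a lower bound for the spectrum.
\<close>

lemma finite_eigenvalues_symmetric:
  fixes A :: "real^'n^'n"
  assumes sym: "transpose A = A"
  shows "finite (eigenvalues A)"
proof -
  obtain f :: "'n \<Rightarrow> real^'n" and d
    where eig: "\<And>i. A *v f i = d i *\<^sub>R f i" and sp: "span (range f) = UNIV"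
    using symmetric_matrix_orthonormal_eigenbasis[OF sym] by metis
  have "mu \<in> range d" if "v \<noteq> 0" "A *v v = mu *\<^sub>R v" for mu v
  proof -
    obtain i where i: "v \<bullet> f i \<noteq> 0"
    proof (rule ccontr)
      assume "\<not> thesis"
      with that have "\<forall>x\<in>range f. orthogonal v x" by (auto simp: orthogonal_def)
      then have "orthogonal v v" using sp orthogonal_to_span by (metis UNIV_I)
      with \<open>v \<noteq> 0\<close> show False by (simp add: orthogonal_def)
    qed
    have "d i * (v \<bullet> f i) = mu * (v \<bullet> f i)"
      using symmetric_matrix_inner[OF sym, of v "f i"] that eig by simp
    with i show ?thesis by auto
  qed
  then have "eigenvalues A \<subseteq> range d" by (auto simp: eigenvalues_def)
  then show ?thesis by (simp add: finite_subset)
qed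

section \<open>Monotonicity of the determinant\<close>

text \<open>
  Written in this form, a congruence by a matrix of eigenvectors can be read off from the
  orthonormality relations alone.
\<close>

lemma congruence_entry:
  fixes A :: "real^'n^'n" and T :: "real^'m^'n"
  shows "(transpose T ** A ** T) $ i $ j = column i T \<bullet> (A *v column j T)"
proof -
  have "transpose T ** A ** T = transpose T ** (A ** T)" by (simp add: matrix_mul_assoc)
  then show ?thesis
    by (simp add: matrix_mult_transpose_dot_column matrix_matrix_mult_def transpose_def column_def
        inner_vec_def matrix_vector_mult_def)
qed

text \<open>
  The columns of \<open>T\<close> are the vectors of an orthonormal eigenbasis, each divided by the square root of
  its eigenvalue.
\<close>

lemma symmetric_congruent_identity:
  fixes B :: "real^'n^'n"
  assumes sym: "transpose B = B" and pos: "\<And>mu. mu \<in> eigenvalues B \<Longrightarrow> mu > 0"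
  obtains T :: "real^'n^'n" where "transpose T ** B ** T = mat 1"
proof -
  obtain f :: "'n \<Rightarrow> real^'n" and d
    where on: "\<And>i j. f i \<bullet> f j = (if i = j then 1 else 0)" and eig: "\<And>i. B *v f i = d i *\<^sub>R f i"
    using symmetric_matrix_orthonormal_eigenbasis[OF sym] by metis
  have d: "d i > 0" for i
  proof -
    have "f i \<noteq> 0" using on[of i i] by auto
    then show ?thesis using eig pos by (auto simp: eigenvalues_def)
  qed
  define T :: "real^'n^'n" where "T = (\<chi> i j. (f j /\<^sub>R sqrt (d j)) $ i)"
  have col: "column j T = f j /\<^sub>R sqrt (d j)" for j
    by (simp add: T_def column_def vec_eq_iff)
  have "transpose T ** B ** T = mat 1"
    using d d[THEN less_imp_neq] by (auto simp: vec_eq_iff congruence_entry col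
        matrix_vector_mult_scaleR eig on mat_def less_imp_le real_sqrt_mult_self field_simps)
  then show ?thesis by (rule that)
qed

lemma det_identity_plus_psd_ge_1:
  fixes E :: "real^'n^'n"
  assumes sym: "transpose E = E" and psd: "\<And>x. x \<bullet> (E *v x) \<ge> 0"
  shows "det (mat 1 + E) \<ge> 1"
proof -
  obtain f :: "'n \<Rightarrow> real^'n" and d
    where on: "\<And>i j. f i \<bullet> f j = (if i = j then 1 else 0)" and eig: "\<And>i. E *v f i = d i *\<^sub>R f i"
    using symmetric_matrix_orthonormal_eigenbasis[OF sym] by metis
  have d: "d i \<ge> 0" for i
    using psd[of "f i"] by (simp add: eig on)
  define Q :: "real^'n^'n" where "Q = (\<chi> i j. f j $ i)"
  have col: "column j Q = f j" for j
    by (simp add: Q_def column_def vec_eq_iff)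
  have "transpose Q ** Q = mat 1"
    by (auto simp: matrix_mult_transpose_dot_column col on vec_eq_iff mat_def)
  then have Q: "det Q * det Q = 1"
    by (metis det_I det_mul det_transpose)
  have diag: "(transpose Q ** (mat 1 + E) ** Q) $ i $ j = (if i = j then 1 + d i else 0)" for i j
    unfolding congruence_entry col
    by (auto simp: matrix_vector_mult_add_rdistrib eig on inner_add_right)
  have "det (transpose Q ** (mat 1 + E) ** Q) = (\<Prod>i\<in>UNIV. 1 + d i)"
    by (subst det_diagonal) (simp_all add: diag)
  moreover have "det (transpose Q ** (mat 1 + E) ** Q) = (det Q * det Q) * det (mat 1 + E)"
    by (simp add: det_mul)
  ultimately have "det (mat 1 + E) = (\<Prod>i\<in>UNIV. 1 + d i)"
    using Q by simp
  also have "\<dots> \<ge> 1" using d by (intro prod_ge_1) simp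
  finally show ?thesis .
qed

lemma matrix_diff_ldistrib:
  fixes A :: "real^'n^'m" and B C :: "real^'k^'n"
  shows "A ** (B - C) = A ** B - A ** C"
  by (simp add: matrix_matrix_mult_def vec_eq_iff sum_subtractf right_diff_distrib)

lemma matrix_diff_rdistrib:
  fixes A B :: "real^'n^'m" and C :: "real^'k^'n"
  shows "(A - B) ** C = A ** C - B ** C"
  by (simp add: matrix_matrix_mult_def vec_eq_iff sum_subtractf left_diff_distrib)

lemma matrix_add_rdistrib:
  fixes A B :: "real^'n^'m" and C :: "real^'k^'n"
  shows "(A + B) ** C = A ** C + B ** C"
  by (simp add: matrix_matrix_mult_def vec_eq_iff sum.distrib distrib_right)

lemma transpose_add: "transpose (A + B) = transpose A + transpose (B :: real^'n^'m)"
  by (simp add: transpose_def vec_eq_iff)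

lemma transpose_diff: "transpose (A - B) = transpose A - transpose (B :: real^'n^'m)"
  by (simp add: transpose_def vec_eq_iff)

lemma transpose_congruence:
  fixes S :: "real^'m^'m" and D :: "real^'m^'n"
  assumes "transpose S = S"
  shows "transpose (D ** S ** transpose D) = D ** S ** transpose D"
  using assms by (simp add: matrix_transpose_mul matrix_mul_assoc)

lemma inner_congruence:
  fixes S :: "real^'m^'m" and D :: "real^'m^'n"
  shows "x \<bullet> ((D ** S ** transpose D) *v x) = (transpose D *v x) \<bullet> (S *v (transpose D *v x))"
  by (simp add: matrix_vector_mul_assoc[symmetric] dot_lmul_matrix)

text \<open>
  A congruence by \<open>T\<close> multiplies every determinant by the same positive factor \<open>(det T)\<^sup>2\<close>, so the
  two matrices may be compared after \<open>B\<close> has been turned into the identity.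
\<close>

lemma det_mono_psd:
  fixes B C :: "real^'n^'n"
  assumes symB: "transpose B = B" and pos: "\<And>mu. mu \<in> eigenvalues B \<Longrightarrow> mu > 0"
    and symC: "transpose C = C" and psd: "\<And>x. x \<bullet> (C *v x) \<ge> 0"
  shows "0 < det B" "det B \<le> det (B + C)"
proof -
  obtain T :: "real^'n^'n" where T: "transpose T ** B ** T = mat 1"
    using symmetric_congruent_identity[OF symB pos] .
  have one: "(det T)\<^sup>2 * det B = 1"
    using arg_cong[OF T, of det] by (simp add: det_mul power2_eq_square algebra_simps)
  then have sq: "(det T)\<^sup>2 > 0" by (cases "det T = 0") auto
  show "0 < det B" using one sq by (metis zero_less_mult_pos zero_less_one)
  let ?E = "transpose T ** C ** T"
  have "1 \<le> det (mat 1 + ?E)"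
  proof (rule det_identity_plus_psd_ge_1)
    show "transpose ?E = ?E" using transpose_congruence[OF symC, of "transpose T"] by simp
    show "x \<bullet> (?E *v x) \<ge> 0" for x
      using inner_congruence[of x "transpose T" C] psd by simp
  qed
  also have "mat 1 + ?E = transpose T ** (B + C) ** T"
    by (simp add: T[symmetric] matrix_add_ldistrib matrix_add_rdistrib)
  also have "det \<dots> = (det T)\<^sup>2 * det (B + C)"
    by (simp add: det_mul power2_eq_square algebra_simps)
  finally show "det B \<le> det (B + C)" using one sq
    by (metis mult_le_cancel_left_pos)
qed

lemma abs_det_minus: "\<bar>det (- A)\<bar> = \<bar>det (A :: real^'n^'n)\<bar>"
proof -
  have "- A = (\<chi> i. (-1) *s (A $ i))" by (simp add: vec_eq_iff)
  then have "det (- A) = (\<Prod>i\<in>(UNIV::'n set). -1) * det A"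
    using det_rows_mul[of "\<lambda>_. -1" "\<lambda>i. A $ i"] by (simp add: vec_lambda_eta)
  then show ?thesis by (simp add: abs_mult power_abs)
qed

section \<open>Completing the square in the gain\<close>

lemma sym_pos_def_nonneg:
  assumes "sym_pos_def S"
  shows "x \<bullet> (S *v x) \<ge> 0"
  using assms unfolding sym_pos_def_def by (cases "x = 0") (auto simp: less_imp_le)

lemma sym_pos_def_invertible:
  fixes S :: "real^'m^'m"
  assumes "sym_pos_def S"
  shows "invertible S"
proof -
  have "x = 0" if "S *v x = 0" for x
    using assms that unfolding sym_pos_def_def by (metis inner_zero_right less_irrefl)
  then show ?thesis
    by (simp add: invertible_left_inverse matrix_left_invertible_ker)
qed

lemma matrix_inv_left:
  assumes "invertible A"
  shows "matrix_inv A ** A = mat 1"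
  using someI_ex[OF assms[unfolded invertible_def]] by (simp add: matrix_inv_def)

text \<open>
  This matrix, inverted in the Kalman gain, is known as the innovation covariance; its positive
  definiteness gives both that inverse and the sign of the quadratic term in \<open>K\<close>. The term \<open>R\<close> makes
  it definite even when \<open>H\<close> does not have full row rank.
\<close>

lemma sym_pos_def_innovation:
  fixes P :: "real^'n^'n" and R :: "real^'m^'m" and H :: "real^'n^'m"
  assumes P: "sym_pos_def P" and R: "sym_pos_def R"
  shows "sym_pos_def (H ** P ** transpose H + R)"
proof -
  have symP: "transpose P = P" using P by (simp add: sym_pos_def_def)
  show ?thesis
    using R transpose_congruence[OF symP, of H] inner_congruence[of _ H P] sym_pos_def_nonneg[OF P]
    unfolding sym_pos_def_def
    by (auto simp: transpose_add matrix_vector_mult_add_rdistrib inner_add_right add_nonneg_pos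
        simp del: transpose_matrix_vector)
qed

lemma transpose_cov:
  assumes "sym_pos_def P" and "sym_pos_def R"
  shows "transpose (cov P R H K) = cov P R H K"
  using assms
  by (simp add: cov_def sym_pos_def_def transpose_add matrix_transpose_mul matrix_mul_assoc)

text \<open>
  The gain enters only through \<open>G S = P H\<^sup>T\<close> and its transpose, which rewrite the terms of
  \<open>cov P R H L\<close> that are linear in \<open>L\<close> as the cross terms of a square centred at \<open>G\<close>.
\<close>

lemma cov_completed_square:
  fixes P :: "real^'n^'n" and R :: "real^'m^'m" and H :: "real^'n^'m" and K :: "real^'m^'n"
  assumes P: "sym_pos_def P" and R: "sym_pos_def R"
  defines "S \<equiv> H ** P ** transpose H + R"
  defines "G \<equiv> kalman_gain P R H"
  shows "cov P R H K = cov P R H G + (K - G) ** S ** transpose (K - G)"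
proof -
  have S: "sym_pos_def S" unfolding S_def by (rule sym_pos_def_innovation[OF P R])
  then have symS: "transpose S = S" and symP: "transpose P = P"
    using P by (auto simp: sym_pos_def_def)
  have GS: "P ** transpose H = G ** S"
  proof -
    have "G ** S = P ** transpose H ** (matrix_inv S ** S)"
      by (simp add: G_def kalman_gain_def S_def matrix_mul_assoc)
    then show ?thesis
      using matrix_inv_left[OF sym_pos_def_invertible[OF S]] by simp
  qed
  have HP: "H ** P = S ** transpose G"
    using arg_cong[OF GS, of transpose] by (simp add: matrix_transpose_mul symS symP)
  have *: "cov P R H L = P - L ** S ** transpose G - G ** S ** transpose L + L ** S ** transpose L" for L
  proof -
    have "cov P R H L = P - L ** (H ** P) - P ** transpose H ** transpose L
        + (L ** (H ** P ** transpose H) ** transpose L + L ** R ** transpose L)"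
      by (simp add: cov_def matrix_diff_ldistrib matrix_diff_rdistrib transpose_diff
          matrix_transpose_mul matrix_mul_assoc algebra_simps)
    also have "L ** (H ** P ** transpose H) ** transpose L + L ** R ** transpose L = L ** S ** transpose L"
      by (simp add: S_def matrix_add_ldistrib matrix_add_rdistrib)
    finally show ?thesis by (simp add: GS HP matrix_mul_assoc)
  qed
  show ?thesis
    unfolding * by (simp add: transpose_diff matrix_diff_ldistrib matrix_diff_rdistrib)
qed

section \<open>Vanishing derivatives\<close>

text \<open>
  Each entry is a linear combination of products of two entries of \<open>K - G\<close>, and both factors vanish
  at \<open>G\<close>.
\<close>

lemma quadratic_entry_has_derivative_0:
  fixes S :: "real^'m^'m" and G :: "real^'m^'n"
  shows "((\<lambda>K. ((K - G) ** S ** transpose (K - G)) $ i $ j) has_derivative (\<lambda>_. 0)) (at G)"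
proof -
  have lin: "bounded_linear (\<lambda>K::real^'m^'n. K $ i $ k)" for i k
    by (intro bounded_linear_compose[OF bounded_linear_vec_nth] bounded_linear_vec_nth)
  have entry: "((\<lambda>K. (K - G) $ i $ k) has_derivative (\<lambda>h. h $ i $ k)) (at G)" for i k
    using has_derivative_diff[OF bounded_linear_imp_has_derivative[OF lin, of i k]
        has_derivative_const, of "G $ i $ k" "at G"]
    by simp
  have "((\<lambda>K. \<Sum>l\<in>UNIV. \<Sum>k\<in>UNIV. ((K - G) $ i $ k * (K - G) $ j $ l) * S $ k $ l)
      has_derivative (\<lambda>_. \<Sum>l\<in>(UNIV::'m set). \<Sum>k\<in>(UNIV::'m set). 0)) (at G)"
  proof (intro has_derivative_sum)
    fix k l
    show "((\<lambda>K. ((K - G) $ i $ k * (K - G) $ j $ l) * S $ k $ l) has_derivative (\<lambda>_. 0)) (at G)"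
      using has_derivative_mult_left[OF has_derivative_mult[OF entry[of i k] entry[of j l]], of "S $ k $ l"]
      by simp
  qed
  moreover have "(\<lambda>K. ((K - G) ** S ** transpose (K - G)) $ i $ j)
      = (\<lambda>K. \<Sum>l\<in>UNIV. \<Sum>k\<in>UNIV. ((K - G) $ i $ k * (K - G) $ j $ l) * S $ k $ l)"
    by (simp add: matrix_matrix_mult_def transpose_def sum_distrib_right sum_distrib_left mult_ac)
  ultimately show ?thesis by simp
qed

text \<open>
  By the product rule, each term in the derivative of the Leibniz expansion carries the derivative of
  one entry as a factor.
\<close>

lemma det_has_derivative_0:
  fixes F :: "'a::real_normed_vector \<Rightarrow> real^'n^'n"
  assumes "\<And>i j. ((\<lambda>x. F x $ i $ j) has_derivative (\<lambda>_. 0)) (at a)"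
  shows "((\<lambda>x. det (F x)) has_derivative (\<lambda>_. 0)) (at a)"
proof -
  have "((\<lambda>x. det (F x)) has_derivative
     (\<lambda>_. \<Sum>p\<in>{p. p permutes (UNIV::'n set)}. of_int (sign p) *
        (\<Sum>i\<in>UNIV. 0 * (\<Prod>j\<in>UNIV - {i}. F a $ j $ p j)))) (at a)"
    unfolding det_def
    by (intro has_derivative_sum has_derivative_mult_right has_derivative_prod assms)
  then show ?thesis by simp
qed

lemma abs_has_derivative_0:
  fixes f :: "'a::real_normed_vector \<Rightarrow> real"
  assumes f: "(f has_derivative (\<lambda>_. 0)) (at a)" and nz: "f a \<noteq> 0"
  shows "((\<lambda>x. \<bar>f x\<bar>) has_derivative (\<lambda>_. 0)) (at a)"
  using has_derivative_compose[OF f has_derivative_norm[OF nz]] by simp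

lemma char_fun_nonzero:
  assumes "lam \<notin> eigenvalues A"
  shows "char_fun A lam \<noteq> 0"
proof -
  have "x = 0" if "(lam *\<^sub>R mat 1 - A) *v x = 0" for x
  proof (rule ccontr)
    assume "x \<noteq> 0"
    moreover have "A *v x = lam *\<^sub>R x"
      using that by (simp add: matrix_vector_mult_diff_rdistrib scaleR_matrix_vector_assoc[symmetric])
    ultimately show False using assms by (auto simp: eigenvalues_def)
  qed
  then have "invertible (lam *\<^sub>R mat 1 - A)"
    by (simp add: invertible_left_inverse matrix_left_invertible_ker)
  then show ?thesis by (simp add: char_fun_def invertible_det_nz)
qed

section \<open>Optimality of the Kalman gain\<close>

theorem theorem1:
  fixes P :: "real^'n^'n" and R :: "real^'m^'m" and H :: "real^'n^'m"
    and lam :: real and g :: "real^'m^'n \<Rightarrow> real" and Kstar :: "real^'m^'n"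
  assumes "sym_pos_def P" and "sym_pos_def R"
  defines "Kstar \<equiv> kalman_gain P R H"
  defines "g \<equiv> \<lambda>K. \<bar>char_fun (cov P R H K) lam\<bar>"
  assumes "lam \<notin> eigenvalues (cov P R H Kstar)"
  shows "critical_point g Kstar \<and>
    (lam < smallest_eigenvalue (cov P R H Kstar) \<longrightarrow> (\<forall>K. g Kstar \<le> g K))"
proof
  define S where "S = H ** P ** transpose H + R"
  define Q where "Q K = (K - Kstar) ** S ** transpose (K - Kstar)" for K
  let ?A = "cov P R H Kstar"
  have cov: "cov P R H K = ?A + Q K" for K
    using cov_completed_square[OF assms(1,2), of H K] by (simp add: Kstar_def S_def Q_def)
  have "((\<lambda>K. det (lam *\<^sub>R mat 1 - (?A + Q K))) has_derivative (\<lambda>_. 0)) (at Kstar)"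
  proof (rule det_has_derivative_0)
    fix i j
    show "((\<lambda>K. (lam *\<^sub>R mat 1 - (?A + Q K)) $ i $ j) has_derivative (\<lambda>_. 0)) (at Kstar)"
      using has_derivative_diff[OF has_derivative_const[of "(lam *\<^sub>R mat 1 - ?A) $ i $ j"]
          quadratic_entry_has_derivative_0[of Kstar S i j]]
      by (simp add: Q_def algebra_simps)
  qed
  then have "((\<lambda>K. char_fun (cov P R H K) lam) has_derivative (\<lambda>_. 0)) (at Kstar)"
    by (simp add: char_fun_def cov[symmetric])
  then show "critical_point g Kstar"
    unfolding critical_point_def g_def
    by (rule abs_has_derivative_0) (rule char_fun_nonzero[OF assms(5)])
  show "lam < smallest_eigenvalue ?A \<longrightarrow> (\<forall>K. g Kstar \<le> g K)"
  proof (intro impI allI)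
    fix K assume less: "lam < smallest_eigenvalue ?A"
    have symA: "transpose ?A = ?A" by (rule transpose_cov[OF assms(1,2)])
    let ?B = "?A - lam *\<^sub>R mat 1"
    have symB: "transpose ?B = ?B" by (simp add: transpose_diff transpose_scalar symA)
    have pos: "mu > 0" if "mu \<in> eigenvalues ?B" for mu
    proof -
      have "mu + lam \<in> eigenvalues ?A"
        using that by (auto simp: eigenvalues_def matrix_vector_mult_diff_rdistrib
            scaleR_matrix_vector_assoc[symmetric] algebra_simps)
      then have "smallest_eigenvalue ?A \<le> mu + lam"
        unfolding smallest_eigenvalue_def
        by (intro Min_le finite_eigenvalues_symmetric symA)
      with less show ?thesis by linarith
    qed
    have S: "sym_pos_def S" unfolding S_def by (rule sym_pos_def_innovation[OF assms(1,2)])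
    have symQ: "transpose (Q K) = Q K"
      unfolding Q_def by (rule transpose_congruence) (use S in \<open>simp add: sym_pos_def_def\<close>)
    have psdQ: "x \<bullet> (Q K *v x) \<ge> 0" for x
      unfolding Q_def inner_congruence by (rule sym_pos_def_nonneg[OF S])
    have "g L = \<bar>det (?B + Q L)\<bar>" for L
      using abs_det_minus[of "?B + Q L"]
      by (simp add: g_def char_fun_def cov[of L] algebra_simps)
    moreover have "Q Kstar = 0" by (simp add: Q_def matrix_matrix_mult_def vec_eq_iff)
    ultimately show "g Kstar \<le> g K"
      using det_mono_psd[OF symB pos symQ psdQ] by simp
  qed
qed

end
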